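(* Let $(M,\varphi,\xi,\eta,g,\varepsilon,a,b,c)$ be a regular Einstein-like $(\varepsilon)$-almost paracontact metric manifold with torse-forming characteristic vector field $\xi$, let $\mu$ be a real constant, and set $\alpha:=\frac12\mathcal{L}_\xi g+S+\mu\,\eta\otimes\eta$. Then $\alpha$ is parallel ($\nabla\alpha=0$) if and only if $(g,\xi,\lambda,\mu)$ with $\lambda=-(a+\varepsilon(c+\mu))$ is an $\eta$-Ricci soliton on $M$.
   Context: An $(\varepsilon)$-almost paracontact metric structure $(\varphi,\xi,\eta,g,\varepsilon)$ on an $n$-dimensional manifold $M$ consists of a $(1,1)$-tensor field $\varphi$, a vector field $\xi$ (the characteristic vector field), a $1$-form $\eta$, a pseudo-Riemannian metric $g$ and $\varepsilon\in\{1,-1\}$ with $\varphi^2=I-\eta\otimes\xi$, $\eta(\xi)=1$, $\varphi\xi=0$, $\eta\circ\varphi=0$ and $g(\varphi X,\varphi Y)=g(X,Y)-\varepsilon\eta(X)\eta(Y)$ for all vector fields $X,Y$. (Consequently $g(X,\xi)=\varepsilon\eta(X)$ and $g(\varphi X,Y)=g(X,\varphi Y)$.) $\nabla$ is the Levi-Civita connection of $g$ and $S$ the Ricci tensor. $(M,\varphi,\xi,\eta,g,\varepsilon,a,b,c)$ is Einstein-like if $a,b,c$ are real constants with $S(X,Y)=a\,g(X,Y)+b\,g(\varphi X,Y)+c\,\eta(X)\eta(Y)$ for all vector fields $X,Y$. $\xi$ is torse-forming if $\nabla_X\xi=fX+w(X)\xi$ for all vector fields $X$, for some smooth function $f$ and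 some $1$-form $w$ (necessarily $w=-f\eta$). A manifold with torse-forming characteristic vector field is regular if $f^2+\xi(f)\neq0$ (on $M$). $(g,\xi,\lambda,\mu)$ is an $\eta$-Ricci soliton if $\lambda,\mu$ are real constants and $\frac12\mathcal{L}_\xi g+S+\lambda g+\mu\,\eta\otimes\eta=0$. *)

theory Defs
  imports "HOL-Analysis.Analysis" "HOL-Library.Function_Algebras"
begin

text \<open>
  Tangent vectors are represented as derivations, that is, as real-valued functions on real
  functions.  The pointwise real vector space structure on functions makes the library's span,
  independence and coordinates available for them.
\<close>

instantiation "fun" :: (type, real_vector) real_vector
begin

definition scaleR_fun :: "real \<Rightarrow> ('a \<Rightarrow> 'b) \<Rightarrow> 'a \<Rightarrow> 'b"
  where "scaleR_fun r f = (\<lambda>x. r *\<^sub>R f x)"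

instance
  by standard (simp_all add: scaleR_fun_def fun_eq_iff scaleR_add_right scaleR_add_left)

end

lemma scaleR_fun_apply [simp]: "(r *\<^sub>R f) x = r *\<^sub>R f x"
  by (simp add: scaleR_fun_def)

text \<open>
  \<open>C_on k S f\<close>: all partial derivatives of \<open>f\<close> of order at most \<open>k\<close> exist and are continuous
  on the open set \<open>S\<close>.
\<close>

primrec C_on :: "nat \<Rightarrow> 'e::euclidean_space set \<Rightarrow> ('e \<Rightarrow> 'f::real_normed_vector) \<Rightarrow> bool"
  where
    "C_on 0 S f \<longleftrightarrow> continuous_on S f"
  | "C_on (Suc k) S f \<longleftrightarrow>
       f differentiable_on S \<and> (\<forall>i\<in>Basis. C_on k S (\<lambda>x. frechet_derivative f (at x) i))"

definition smooth_on :: "'e::euclidean_space set \<Rightarrow> ('e \<Rightarrow> 'f::real_normed_vector) \<Rightarrow> bool"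
  where "smooth_on S f \<longleftrightarrow> (\<forall>k. C_on k S f)"

text \<open>A chart is a pair of its domain and the coordinate map.\<close>

type_synonym ('m, 'e) chart = "'m set \<times> ('m \<Rightarrow> 'e)"

definition is_chart ::
    "('m::topological_space, 'e::euclidean_space) chart \<Rightarrow> bool"
  where "is_chart c \<longleftrightarrow> (case c of (U, \<psi>) \<Rightarrow>
      open U \<and> open (\<psi> ` U) \<and> homeomorphism U (\<psi> ` U) \<psi> (inv_into U \<psi>))"

text \<open>
  The manifold is the whole Hausdorff, second countable type \<open>'m\<close>; its dimension is
  \<open>DIM('e)\<close>.
\<close>

definition smooth_atlas ::
    "('m::{t2_space, second_countable_topology}, 'e::euclidean_space) chart set \<Rightarrow> bool"
  where "smooth_atlas A \<longleftrightarrow>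
      (\<forall>c\<in>A. is_chart c) \<and> (\<Union>(U, \<psi>)\<in>A. U) = UNIV \<and>
      (\<forall>(U, \<psi>)\<in>A. \<forall>(V, \<theta>)\<in>A. smooth_on (\<psi> ` (U \<inter> V)) (\<theta> \<circ> inv_into U \<psi>))"

definition smooth_fun ::
    "('m, 'e::euclidean_space) chart set \<Rightarrow> ('m \<Rightarrow> real) \<Rightarrow> bool"
  where "smooth_fun A h \<longleftrightarrow> (\<forall>(U, \<psi>)\<in>A. smooth_on (\<psi> ` U) (h \<circ> inv_into U \<psi>))"

type_synonym 'm tangent_vector = "('m \<Rightarrow> real) \<Rightarrow> real"

type_synonym 'm vfield = "'m \<Rightarrow> 'm tangent_vector"

text \<open>
  Derivations at \<open>p\<close> of the algebra of smooth functions.  They are set to 0 on non-smooth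
  functions, so that two tangent vectors are equal as soon as they agree on smooth functions.
\<close>

definition tangent_space ::
    "('m, 'e::euclidean_space) chart set \<Rightarrow> 'm \<Rightarrow> 'm tangent_vector set"
  where "tangent_space A p = {v.
      (\<forall>h. \<not> smooth_fun A h \<longrightarrow> v h = 0) \<and>
      (\<forall>h k r s. smooth_fun A h \<longrightarrow> smooth_fun A k \<longrightarrow>
          v (\<lambda>q. r * h q + s * k q) = r * v h + s * v k) \<and>
      (\<forall>h k. smooth_fun A h \<longrightarrow> smooth_fun A k \<longrightarrow>
          v (\<lambda>q. h q * k q) = v h * k p + h p * v k)}"

definition vector_field :: "('m, 'e::euclidean_space) chart set \<Rightarrow> 'm vfield \<Rightarrow> bool"
  where "vector_field A X \<longleftrightarrow>
      (\<forall>p. X p \<in> tangent_space A p) \<and>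
      (\<forall>h. smooth_fun A h \<longrightarrow> smooth_fun A (\<lambda>p. X p h))"

definition mult_field :: "('m \<Rightarrow> real) \<Rightarrow> 'm vfield \<Rightarrow> 'm vfield"  (infixr "\<cdot>\<^sub>v" 75)
  where "f \<cdot>\<^sub>v X = (\<lambda>p. f p *\<^sub>R X p)"

text \<open>For non-smooth \<open>h\<close> the value is 0, as required of tangent vectors.\<close>

definition lie_bracket :: "'m vfield \<Rightarrow> 'm vfield \<Rightarrow> 'm vfield"
  where "lie_bracket X Y = (\<lambda>p h. X p (\<lambda>q. Y q h) - Y p (\<lambda>q. X q h))"

definition linear_on_set :: "'a::real_vector set \<Rightarrow> ('a \<Rightarrow> 'b::real_vector) \<Rightarrow> bool"
  where "linear_on_set V L \<longleftrightarrow>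
      (\<forall>u\<in>V. \<forall>v\<in>V. \<forall>r s. L (r *\<^sub>R u + s *\<^sub>R v) = r *\<^sub>R L u + s *\<^sub>R L v)"

definition one_form ::
    "('m, 'e::euclidean_space) chart set \<Rightarrow> ('m \<Rightarrow> 'm tangent_vector \<Rightarrow> real) \<Rightarrow> bool"
  where "one_form A \<eta> \<longleftrightarrow>
      (\<forall>p. linear_on_set (tangent_space A p) (\<eta> p)) \<and>
      (\<forall>X. vector_field A X \<longrightarrow> smooth_fun A (\<lambda>p. \<eta> p (X p)))"

definition tensor11 ::
    "('m, 'e::euclidean_space) chart set \<Rightarrow>
      ('m \<Rightarrow> 'm tangent_vector \<Rightarrow> 'm tangent_vector) \<Rightarrow> bool"
  where "tensor11 A \<phi> \<longleftrightarrow>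
      (\<forall>p. linear_on_set (tangent_space A p) (\<phi> p) \<and>
           \<phi> p ` tangent_space A p \<subseteq> tangent_space A p) \<and>
      (\<forall>X. vector_field A X \<longrightarrow> vector_field A (\<lambda>p. \<phi> p (X p)))"

definition pseudo_riemannian_metric ::
    "('m, 'e::euclidean_space) chart set \<Rightarrow>
      ('m \<Rightarrow> 'm tangent_vector \<Rightarrow> 'm tangent_vector \<Rightarrow> real) \<Rightarrow> bool"
  where "pseudo_riemannian_metric A g \<longleftrightarrow>
      (\<forall>p. \<forall>u\<in>tangent_space A p.
          linear_on_set (tangent_space A p) (g p u) \<and>
          linear_on_set (tangent_space A p) (\<lambda>v. g p v u)) \<and>
      (\<forall>p. \<forall>u\<in>tangent_space A p. \<forall>v\<in>tangent_space A p. g p u v = g p v u) \<and>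
      (\<forall>p. \<forall>u\<in>tangent_space A p. (\<forall>v\<in>tangent_space A p. g p u v = 0) \<longrightarrow> u = 0) \<and>
      (\<forall>X Y. vector_field A X \<longrightarrow> vector_field A Y \<longrightarrow> smooth_fun A (\<lambda>p. g p (X p) (Y p)))"

definition affine_connection ::
    "('m, 'e::euclidean_space) chart set \<Rightarrow> ('m vfield \<Rightarrow> 'm vfield \<Rightarrow> 'm vfield) \<Rightarrow> bool"
  where "affine_connection A nab \<longleftrightarrow>
      (\<forall>X Y. vector_field A X \<longrightarrow> vector_field A Y \<longrightarrow> vector_field A (nab X Y)) \<and>
      (\<forall>f h X Y Z. smooth_fun A f \<longrightarrow> smooth_fun A h \<longrightarrow>
          vector_field A X \<longrightarrow> vector_field A Y \<longrightarrow> vector_field A Z \<longrightarrow>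
          nab (f \<cdot>\<^sub>v X + h \<cdot>\<^sub>v Y) Z = f \<cdot>\<^sub>v nab X Z + h \<cdot>\<^sub>v nab Y Z) \<and>
      (\<forall>X Y Z. vector_field A X \<longrightarrow> vector_field A Y \<longrightarrow> vector_field A Z \<longrightarrow>
          nab X (Y + Z) = nab X Y + nab X Z) \<and>
      (\<forall>f X Y. smooth_fun A f \<longrightarrow> vector_field A X \<longrightarrow> vector_field A Y \<longrightarrow>
          nab X (f \<cdot>\<^sub>v Y) = (\<lambda>p. X p f) \<cdot>\<^sub>v Y + f \<cdot>\<^sub>v nab X Y)"

definition levi_civita ::
    "('m, 'e::euclidean_space) chart set \<Rightarrow>
      ('m \<Rightarrow> 'm tangent_vector \<Rightarrow> 'm tangent_vector \<Rightarrow> real) \<Rightarrow>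
      ('m vfield \<Rightarrow> 'm vfield \<Rightarrow> 'm vfield) \<Rightarrow> bool"
  where "levi_civita A g nab \<longleftrightarrow>
      affine_connection A nab \<and>
      (\<forall>X Y. vector_field A X \<longrightarrow> vector_field A Y \<longrightarrow>
          nab X Y - nab Y X = lie_bracket X Y) \<and>
      (\<forall>X Y Z. vector_field A X \<longrightarrow> vector_field A Y \<longrightarrow> vector_field A Z \<longrightarrow>
          (\<forall>p. X p (\<lambda>q. g q (Y q) (Z q)) = g p (nab X Y p) (Z p) + g p (Y p) (nab X Z p)))"

definition curvature ::
    "('m vfield \<Rightarrow> 'm vfield \<Rightarrow> 'm vfield) \<Rightarrow> 'm vfield \<Rightarrow> 'm vfield \<Rightarrow> 'm vfield \<Rightarrow> 'm vfield"
  where "curvature nab X Y Z =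
      nab X (nab Y Z) - nab Y (nab X Z) - nab (lie_bracket X Y) Z"

text \<open>For finite-dimensional \<open>V\<close> and linear \<open>L\<close> mapping \<open>V\<close> to itself, the value does not depend on the basis \<open>B\<close>.\<close>

definition trace_on :: "'a::real_vector set \<Rightarrow> ('a \<Rightarrow> 'a) \<Rightarrow> real"
  where "trace_on V L =
      (let B = (SOME B. independent B \<and> span B = V) in \<Sum>b\<in>B. representation B (L b) b)"

text \<open>
  \<open>Ric(Y, Z)\<close> at \<open>p\<close> is the trace of \<open>v \<mapsto> R(v, Y)Z\<close> on the tangent space; as the curvature
  operates on vector fields and is tensorial, \<open>v\<close> is extended to an arbitrary vector field.
\<close>

definition ricci ::
    "('m, 'e::euclidean_space) chart set \<Rightarrow> ('m vfield \<Rightarrow> 'm vfield \<Rightarrow> 'm vfield) \<Rightarrow>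
      'm vfield \<Rightarrow> 'm vfield \<Rightarrow> 'm \<Rightarrow> real"
  where "ricci A nab Y Z p =
      trace_on (tangent_space A p)
        (\<lambda>v. curvature nab (SOME V. vector_field A V \<and> V p = v) Y Z p)"

definition lie_derivative_metric ::
    "'m vfield \<Rightarrow> ('m \<Rightarrow> 'm tangent_vector \<Rightarrow> 'm tangent_vector \<Rightarrow> real) \<Rightarrow>
      'm vfield \<Rightarrow> 'm vfield \<Rightarrow> 'm \<Rightarrow> real"
  where "lie_derivative_metric V g X Y p =
      V p (\<lambda>q. g q (X q) (Y q)) - g p (lie_bracket V X p) (Y p) - g p (X p) (lie_bracket V Y p)"

text \<open>\<open>\<nabla>\<alpha> = 0\<close> for a (0,2)-tensor field \<open>\<alpha>\<close>, given by its values on vector fields.\<close>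

definition parallel ::
    "('m, 'e::euclidean_space) chart set \<Rightarrow> ('m vfield \<Rightarrow> 'm vfield \<Rightarrow> 'm vfield) \<Rightarrow>
      ('m vfield \<Rightarrow> 'm vfield \<Rightarrow> 'm \<Rightarrow> real) \<Rightarrow> bool"
  where "parallel A nab \<alpha> \<longleftrightarrow>
      (\<forall>X Y Z. vector_field A X \<longrightarrow> vector_field A Y \<longrightarrow> vector_field A Z \<longrightarrow>
          (\<forall>p. X p (\<alpha> Y Z) - \<alpha> (nab X Y) Z p - \<alpha> Y (nab X Z) p = 0))"

definition almost_paracontact_metric ::
    "('m, 'e::euclidean_space) chart set \<Rightarrow>
      ('m \<Rightarrow> 'm tangent_vector \<Rightarrow> 'm tangent_vector) \<Rightarrow> 'm vfield \<Rightarrow>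
      ('m \<Rightarrow> 'm tangent_vector \<Rightarrow> real) \<Rightarrow>
      ('m \<Rightarrow> 'm tangent_vector \<Rightarrow> 'm tangent_vector \<Rightarrow> real) \<Rightarrow> real \<Rightarrow> bool"
  where "almost_paracontact_metric A \<phi> \<xi> \<eta> g \<epsilon> \<longleftrightarrow>
      tensor11 A \<phi> \<and> vector_field A \<xi> \<and> one_form A \<eta> \<and> pseudo_riemannian_metric A g \<and>
      \<epsilon> \<in> {1, -1} \<and>
      (\<forall>p. \<forall>v\<in>tangent_space A p. \<phi> p (\<phi> p v) = v - \<eta> p v *\<^sub>R \<xi> p) \<and>
      (\<forall>p. \<eta> p (\<xi> p) = 1) \<and>
      (\<forall>p. \<phi> p (\<xi> p) = 0) \<and>
      (\<forall>p. \<forall>v\<in>tangent_space A p. \<eta> p (\<phi> p v) = 0) \<and>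
      (\<forall>X Y. vector_field A X \<longrightarrow> vector_field A Y \<longrightarrow>
          (\<forall>p. g p (\<phi> p (X p)) (\<phi> p (Y p)) =
                g p (X p) (Y p) - \<epsilon> * \<eta> p (X p) * \<eta> p (Y p)))"

definition einstein_like ::
    "('m, 'e::euclidean_space) chart set \<Rightarrow>
      ('m \<Rightarrow> 'm tangent_vector \<Rightarrow> 'm tangent_vector) \<Rightarrow>
      ('m \<Rightarrow> 'm tangent_vector \<Rightarrow> real) \<Rightarrow>
      ('m \<Rightarrow> 'm tangent_vector \<Rightarrow> 'm tangent_vector \<Rightarrow> real) \<Rightarrow>
      ('m vfield \<Rightarrow> 'm vfield \<Rightarrow> 'm vfield) \<Rightarrow> real \<Rightarrow> real \<Rightarrow> real \<Rightarrow> bool"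
  where "einstein_like A \<phi> \<eta> g nab a b c \<longleftrightarrow>
      (\<forall>X Y. vector_field A X \<longrightarrow> vector_field A Y \<longrightarrow>
          (\<forall>p. ricci A nab X Y p =
                a * g p (X p) (Y p) + b * g p (\<phi> p (X p)) (Y p) + c * \<eta> p (X p) * \<eta> p (Y p)))"

definition torse_forming ::
    "('m, 'e::euclidean_space) chart set \<Rightarrow> ('m vfield \<Rightarrow> 'm vfield \<Rightarrow> 'm vfield) \<Rightarrow>
      'm vfield \<Rightarrow> ('m \<Rightarrow> real) \<Rightarrow> ('m \<Rightarrow> 'm tangent_vector \<Rightarrow> real) \<Rightarrow> bool"
  where "torse_forming A nab \<xi> f w \<longleftrightarrow>
      smooth_fun A f \<and> one_form A w \<and>
      (\<forall>X. vector_field A X \<longrightarrow> nab X \<xi> = f \<cdot>\<^sub>v X + (\<lambda>p. w p (X p)) \<cdot>\<^sub>v \<xi>)"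

definition regular :: "'m vfield \<Rightarrow> ('m \<Rightarrow> real) \<Rightarrow> bool"
  where "regular \<xi> f \<longleftrightarrow> (\<forall>p. (f p)\<^sup>2 + \<xi> p f \<noteq> 0)"

definition eta_ricci_soliton ::
    "('m, 'e::euclidean_space) chart set \<Rightarrow> ('m vfield \<Rightarrow> 'm vfield \<Rightarrow> 'm vfield) \<Rightarrow>
      ('m \<Rightarrow> 'm tangent_vector \<Rightarrow> real) \<Rightarrow>
      ('m \<Rightarrow> 'm tangent_vector \<Rightarrow> 'm tangent_vector \<Rightarrow> real) \<Rightarrow> 'm vfield \<Rightarrow>
      real \<Rightarrow> real \<Rightarrow> bool"
  where "eta_ricci_soliton A nab \<eta> g \<xi> lam \<mu> \<longleftrightarrow>
      (\<forall>X Y. vector_field A X \<longrightarrow> vector_field A Y \<longrightarrow>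
          (\<forall>p. 1 / 2 * lie_derivative_metric \<xi> g X Y p + ricci A nab X Y p
                + lam * g p (X p) (Y p) + \<mu> * \<eta> p (X p) * \<eta> p (Y p) = 0))"

end

theory Submission
  imports Defs
begin

text \<open>
  The vector field \<open>\<xi>\<close> satisfies \<open>\<nabla>\<^sub>X \<xi> = f (X - \<eta>(X) \<xi>)\<close>, because \<open>g(\<xi>, \<xi>)\<close> is
  constant.  Hence \<open>1/2 L\<^sub>\<xi> g = f (g - \<epsilon> \<eta> \<otimes> \<eta>)\<close>, and \<open>\<alpha>\<close> is an explicit combination of
  \<open>g\<close>, \<open>g(\<phi> \<cdot>, \<cdot>)\<close> and \<open>\<eta> \<otimes> \<eta>\<close>.  On \<open>\<xi>\<close> the two terms with \<open>f\<close> and with \<open>b\<close> vanish, which gives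
  \<open>\<alpha>(Y, \<xi>) = r g(Y, \<xi>)\<close> with the constant \<open>r = a + \<epsilon> (c + \<mu>)\<close>.  The soliton equation with
  \<open>\<lambda> = -r\<close> says precisely that \<open>\<alpha> = r g\<close>.

  One direction is then the parallelism of \<open>g\<close>.  For the other, let \<open>\<alpha>\<close> be parallel and put
  \<open>h = \<alpha> - r g\<close>, which is parallel too and satisfies \<open>h(\<cdot>, \<xi>) = 0\<close>.  Differentiating this
  identity yields \<open>0 = h(Y, \<nabla>\<^sub>X \<xi>) = f h(Y, X)\<close>, so \<open>h\<close> vanishes wherever \<open>f\<close> does not.  At a zero
  of \<open>f\<close> regularity says \<open>\<xi>(f) \<noteq> 0\<close>, and applying the derivation \<open>\<xi>\<close> to \<open>f h(Y, X) = 0\<close> gives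
  \<open>\<xi>(f) h(Y, X) = 0\<close> there (\<open>zero_of_product_zero\<close>).  This argument, carried out in
  \<open>parallel_eq_multiple_of_metric\<close>, replaces the usual route through the curvature of \<open>\<xi>\<close>: it
  takes one derivative only and stays in the algebra of globally smooth functions, so that local
  extension of tangent vectors is never an issue.
\<close>


section \<open>Linear combinations of smooth functions\<close>

lemma C_on_cong:
  assumes "open S" "C_on k S u" "\<And>x. x \<in> S \<Longrightarrow> u x = v x"
  shows "C_on k S v"
  using assms(2,3)
proof (induction k arbitrary: u v)
  case 0
  then show ?case by (auto cong: continuous_on_cong)
next
  case (Suc k)
  have der: "(v has_derivative frechet_derivative u (at x)) (at x)" if "x \<in> S" for x
  proof -
    have "u differentiable at x"
      using Suc.prems(1) that \<open>open S\<close> by (simp add: differentiable_on_eq_differentiable_at)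
    then have "(u has_derivative frechet_derivative u (at x)) (at x)"
      by (simp add: frechet_derivative_works)
    then show ?thesis
      using has_derivative_transform_within_open \<open>open S\<close> that Suc.prems(2) by blast
  qed
  have "frechet_derivative v (at x) = frechet_derivative u (at x)" if "x \<in> S" for x
    using der[OF that] frechet_derivative_at by metis
  then have "C_on k S (\<lambda>x. frechet_derivative v (at x) i)" if "i \<in> Basis" for i
    using Suc.IH[of "\<lambda>x. frechet_derivative u (at x) i"] Suc.prems(1) that by simp
  moreover have "v differentiable_on S"
    using der \<open>open S\<close> by (auto simp: differentiable_on_eq_differentiable_at differentiable_def)
  ultimately show ?case by simp
qed

lemma C_on_linear_combination:
  fixes u v :: "'e::euclidean_space \<Rightarrow> real"
  assumes "open S" "C_on k S u" "C_on k S v"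
  shows "C_on k S (\<lambda>x. r * u x + s * v x)"
  using assms(2,3)
proof (induction k arbitrary: u v)
  case 0
  then show ?case by (auto intro!: continuous_intros)
next
  case (Suc k)
  have der: "((\<lambda>x. r * u x + s * v x) has_derivative
      (\<lambda>i. r * frechet_derivative u (at x) i + s * frechet_derivative v (at x) i)) (at x)"
    if "x \<in> S" for x
  proof -
    have "u differentiable at x" "v differentiable at x"
      using Suc.prems that \<open>open S\<close> by (simp_all add: differentiable_on_eq_differentiable_at)
    then show ?thesis
      by (auto simp: frechet_derivative_works intro!: derivative_intros)
  qed
  have fd: "r * frechet_derivative u (at x) i + s * frechet_derivative v (at x) i =
      frechet_derivative (\<lambda>x. r * u x + s * v x) (at x) i" if "x \<in> S" for x i
    using frechet_derivative_at[OF der[OF that]] by metis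
  have "C_on k S (\<lambda>x. frechet_derivative (\<lambda>x. r * u x + s * v x) (at x) i)" if "i \<in> Basis" for i
    by (rule C_on_cong[OF \<open>open S\<close> Suc.IH fd]) (use Suc.prems that in auto)
  moreover have "(\<lambda>x. r * u x + s * v x) differentiable_on S"
    using der \<open>open S\<close> by (auto simp: differentiable_on_eq_differentiable_at differentiable_def)
  ultimately show ?case by simp
qed

lemma smooth_fun_linear_combination:
  assumes "smooth_atlas A" "smooth_fun A u" "smooth_fun A v"
  shows "smooth_fun A (\<lambda>q. r * u q + s * v q)"
  unfolding smooth_fun_def
proof clarify
  fix U \<psi> assume c: "(U, \<psi>) \<in> A"
  have "open (\<psi> ` U)"
    using assms(1) c by (force simp: smooth_atlas_def is_chart_def)
  moreover have "smooth_on (\<psi> ` U) (u \<circ> inv_into U \<psi>)" "smooth_on (\<psi> ` U) (v \<circ> inv_into U \<psi>)"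
    using assms(2,3) c by (auto simp: smooth_fun_def)
  ultimately show "smooth_on (\<psi> ` U) ((\<lambda>q. r * u q + s * v q) \<circ> inv_into U \<psi>)"
    by (simp add: smooth_on_def o_def C_on_linear_combination)
qed


section \<open>Tangent vectors as derivations\<close>

lemma tangent_linear:
  assumes "v \<in> tangent_space A p" "smooth_fun A h" "smooth_fun A k"
  shows "v (\<lambda>q. r * h q + s * k q) = r * v h + s * v k"
  using assms unfolding tangent_space_def by blast

lemma tangent_scale:
  assumes "v \<in> tangent_space A p" "smooth_fun A h"
  shows "v (\<lambda>q. r * h q) = r * v h"
  using tangent_linear[OF assms assms(2), of r 0] by simp

lemma tangent_product:
  assumes "v \<in> tangent_space A p" "smooth_fun A h" "smooth_fun A k"
  shows "v (\<lambda>q. h q * k q) = v h * k p + h p * v k"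
  using assms unfolding tangent_space_def by blast

text \<open>
  Comparing linearity and the product rule on \<open>e * e\<close> gives \<open>e * v e = 2 * e * v e\<close>.
\<close>

lemma tangent_constant:
  assumes "v \<in> tangent_space A p" "smooth_fun A (\<lambda>q. e)"
  shows "v (\<lambda>q. e) = 0"
proof (cases "e = 0")
  case True
  then show ?thesis using tangent_scale[OF assms, of 0] by simp
next
  case False
  then show ?thesis
    using tangent_product[OF assms assms(2)] tangent_scale[OF assms, of e] by simp
qed

text \<open>
  This is how regularity enters.  If \<open>f p = 0\<close>, then \<open>v f \<noteq> 0\<close>, and the product rule at \<open>p\<close>
  turns \<open>f h = 0\<close> into \<open>v f * h p = 0\<close>.
\<close>

lemma zero_of_product_zero:
  assumes v: "v \<in> tangent_space A p" and f: "smooth_fun A f" and h: "smooth_fun A h"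
    and fh: "\<And>q. f q * h q = 0" and reg: "(f p)\<^sup>2 + v f \<noteq> 0"
  shows "h p = 0"
proof (cases "f p = 0")
  case True
  have "v f * h p = v (\<lambda>q. f q * h q)"
    using tangent_product[OF v f h] True by simp
  also have "\<dots> = v (\<lambda>q. 0 * f q)"
    by (simp only: fh mult_zero_left)
  also have "\<dots> = 0"
    using tangent_scale[OF v f, of 0] by simp
  finally show ?thesis using reg True by simp
next
  case False
  then show ?thesis using fh[of p] by simp
qed

lemma vector_field_tangent: "vector_field A X \<Longrightarrow> X p \<in> tangent_space A p"
  by (simp add: vector_field_def)

lemma linear_on_setD:
  assumes "linear_on_set V L" "u \<in> V" "v \<in> V"
  shows "L (r *\<^sub>R u + s *\<^sub>R v) = r *\<^sub>R L u + s *\<^sub>R L v"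
  using assms by (simp add: linear_on_set_def)

lemma linear_on_set_diff:
  assumes "linear_on_set V L" "u \<in> V" "v \<in> V"
  shows "L (u - v) = L u - L v"
  using linear_on_setD[OF assms, of 1 "- 1"] by simp


section \<open>Parallel tensors and a torse-forming vector field\<close>

text \<open>
  The difference \<open>h = \<beta> - r g\<close> is parallel because \<open>g\<close> is.  Differentiating \<open>h(Y, \<xi>) = 0\<close>
  along \<open>X\<close> therefore leaves only \<open>h(Y, \<nabla>\<^sub>X \<xi>) = 0\<close>, and in \<open>\<nabla>\<^sub>X \<xi> = f X + w(X) \<xi>\<close> the second
  summand is killed by \<open>h\<close>.
\<close>

lemma parallel_eq_multiple_of_metric:
  assumes A: "smooth_atlas A" and g: "pseudo_riemannian_metric A g"
    and lc: "levi_civita A g nab"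
    and \<xi>: "vector_field A \<xi>" and tf: "torse_forming A nab \<xi> f w" and reg: "regular \<xi> f"
    and lin: "\<And>p u. u \<in> tangent_space A p \<Longrightarrow> linear_on_set (tangent_space A p) (\<beta> p u)"
    and smooth: "\<And>X Y. vector_field A X \<Longrightarrow> vector_field A Y \<Longrightarrow>
      smooth_fun A (\<lambda>p. \<beta> p (X p) (Y p))"
    and par: "parallel A nab (\<lambda>X Y p. \<beta> p (X p) (Y p))"
    and on_\<xi>: "\<And>Y p. vector_field A Y \<Longrightarrow> \<beta> p (Y p) (\<xi> p) = r * g p (Y p) (\<xi> p)"
    and X: "vector_field A X" and Y: "vector_field A Y"
  shows "\<beta> p (Y p) (X p) = r * g p (Y p) (X p)"
proof -
  have nab: "vector_field A (nab V W)" if "vector_field A V" "vector_field A W" for V W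
    using lc that by (simp add: levi_civita_def affine_connection_def)
  have smooth_g: "smooth_fun A (\<lambda>q. g q (V q) (W q))" if "vector_field A V" "vector_field A W" for V W
    using g that by (simp add: pseudo_riemannian_metric_def)
  have lin_g: "linear_on_set (tangent_space A q) (g q u)" if "u \<in> tangent_space A q" for q u
    using g that by (simp add: pseudo_riemannian_metric_def)
  have f: "smooth_fun A f" and nab_\<xi>: "nab X \<xi> q = f q *\<^sub>R X q + w q (X q) *\<^sub>R \<xi> q" for q
    using tf X by (auto simp: torse_forming_def mult_field_def plus_fun_def)
  define h where "h q = 1 * \<beta> q (Y q) (X q) + (- r) * g q (Y q) (X q)" for q
  have "f q * h q = 0" for q
  proof -
    have "\<beta> q (Y q) (nab X \<xi> q) = X q (\<lambda>p. \<beta> p (Y p) (\<xi> p)) - \<beta> q (nab X Y q) (\<xi> q)"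
      using par X Y \<xi> unfolding parallel_def by (simp add: algebra_simps)
    also have "\<dots> = r * (X q (\<lambda>p. g p (Y p) (\<xi> p)) - g q (nab X Y q) (\<xi> q))"
      using tangent_scale[OF vector_field_tangent[OF X] smooth_g[OF Y \<xi>]]
      by (simp add: on_\<xi> Y nab X algebra_simps)
    also have "X q (\<lambda>p. g p (Y p) (\<xi> p)) = g q (nab X Y q) (\<xi> q) + g q (Y q) (nab X \<xi> q)"
      using lc X Y \<xi> by (simp add: levi_civita_def)
    finally have "\<beta> q (Y q) (nab X \<xi> q) = r * g q (Y q) (nab X \<xi> q)" by simp
    then have "f q * \<beta> q (Y q) (X q) = r * (f q * g q (Y q) (X q))"
      using on_\<xi>[OF Y, of q]
      by (simp add: nab_\<xi> linear_on_setD[OF lin] linear_on_setD[OF lin_g]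
          vector_field_tangent X Y \<xi> algebra_simps)
    then show ?thesis by (simp add: h_def algebra_simps)
  qed
  moreover have "smooth_fun A h"
    unfolding h_def using smooth_fun_linear_combination[OF A smooth[OF Y X] smooth_g[OF Y X]] .
  ultimately have "h p = 0"
    using zero_of_product_zero[OF vector_field_tangent[OF \<xi>] f] reg
    by (simp add: regular_def)
  then show ?thesis by (simp add: h_def)
qed

lemma parallel_multiple_of_metric:
  assumes "pseudo_riemannian_metric A g" "levi_civita A g nab"
    and "\<And>X Y p. vector_field A X \<Longrightarrow> vector_field A Y \<Longrightarrow> \<alpha> X Y p = r * g p (X p) (Y p)"
  shows "parallel A nab \<alpha>"
  unfolding parallel_def
proof (intro allI impI)
  fix X Y Z p
  assume X: "vector_field A X" and Y: "vector_field A Y" and Z: "vector_field A Z"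
  have nab: "vector_field A (nab X Y)" "vector_field A (nab X Z)"
    using assms(2) X Y Z by (simp_all add: levi_civita_def affine_connection_def)
  have "smooth_fun A (\<lambda>p. g p (Y p) (Z p))"
    using assms(1) Y Z by (simp add: pseudo_riemannian_metric_def)
  then have "X p (\<lambda>q. r * g q (Y q) (Z q)) = r * X p (\<lambda>q. g q (Y q) (Z q))"
    by (rule tangent_scale[OF vector_field_tangent[OF X]])
  moreover have "\<alpha> Y Z = (\<lambda>q. r * g q (Y q) (Z q))"
    using assms(3) Y Z by auto
  moreover have "X p (\<lambda>q. g q (Y q) (Z q)) = g p (nab X Y p) (Z p) + g p (Y p) (nab X Z p)"
    using assms(2) X Y Z by (simp add: levi_civita_def)
  ultimately show "X p (\<alpha> Y Z) - \<alpha> (nab X Y) Z p - \<alpha> Y (nab X Z) p = 0"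
    by (simp add: assms(3) nab Y Z algebra_simps)
qed


section \<open>The characteristic vector field\<close>

lemma metric_characteristic:
  assumes "almost_paracontact_metric A \<phi> \<xi> \<eta> g \<epsilon>" "vector_field A X"
  shows "g p (X p) (\<xi> p) = \<epsilon> * \<eta> p (X p)"
proof -
  have "\<phi> p (X p) \<in> tangent_space A p"
    using assms by (auto simp: almost_paracontact_metric_def tensor11_def vector_field_def)
  then have lin: "linear_on_set (tangent_space A p) (g p (\<phi> p (X p)))"
    using assms by (simp add: almost_paracontact_metric_def pseudo_riemannian_metric_def)
  have "\<phi> p (\<xi> p) = 0" "\<eta> p (\<xi> p) = 1" and \<xi>: "vector_field A \<xi>"
    using assms(1) by (auto simp: almost_paracontact_metric_def)
  moreover have "g p (\<phi> p (X p)) (\<phi> p (\<xi> p)) = g p (X p) (\<xi> p) - \<epsilon> * \<eta> p (X p) * \<eta> p (\<xi> p)"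
    using assms \<xi> unfolding almost_paracontact_metric_def by blast
  moreover have "g p (\<phi> p (X p)) 0 = 0"
    using linear_on_set_diff[OF lin vector_field_tangent[OF assms(2)]
        vector_field_tangent[OF assms(2)]] by simp
  ultimately show ?thesis by simp
qed

text \<open>
  Since \<open>g(\<xi>, \<xi>) = \<epsilon>\<close> is constant, \<open>g(\<nabla>\<^sub>X \<xi>, \<xi>) = 0\<close>, which forces \<open>w = -f \<eta>\<close>.
\<close>

lemma torse_forming_metric:
  assumes ap: "almost_paracontact_metric A \<phi> \<xi> \<eta> g \<epsilon>" and lc: "levi_civita A g nab"
    and tf: "torse_forming A nab \<xi> f w"
    and X: "vector_field A X" and Y: "vector_field A Y"
  shows "g p (nab X \<xi> p) (Y p) = f p * (g p (X p) (Y p) - \<epsilon> * \<eta> p (X p) * \<eta> p (Y p))"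
proof -
  have \<xi>: "vector_field A \<xi>" and g: "pseudo_riemannian_metric A g" and \<eta>\<xi>: "\<eta> q (\<xi> q) = 1"
    and \<epsilon>: "\<epsilon> * \<epsilon> = 1" for q
    using ap by (auto simp: almost_paracontact_metric_def)
  have sym: "g p u v = g p v u" if "u \<in> tangent_space A p" "v \<in> tangent_space A p" for u v
    using g that unfolding pseudo_riemannian_metric_def by blast
  have nab: "vector_field A (nab X \<xi>)"
    using lc X \<xi> by (simp add: levi_civita_def affine_connection_def)
  have expand: "g p (nab X \<xi> p) (V p) = f p * g p (X p) (V p) + w p (X p) * g p (\<xi> p) (V p)"
    if "vector_field A V" for V
  proof -
    have "nab X \<xi> p = f p *\<^sub>R X p + w p (X p) *\<^sub>R \<xi> p"
      using tf X by (auto simp: torse_forming_def mult_field_def plus_fun_def)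
    moreover have "linear_on_set (tangent_space A p) (\<lambda>v. g p v (V p))"
      using g vector_field_tangent[OF that] by (simp add: pseudo_riemannian_metric_def)
    ultimately show ?thesis
      using linear_on_setD vector_field_tangent[OF X] vector_field_tangent[OF \<xi>] by fastforce
  qed
  have g\<xi>\<xi>: "g q (\<xi> q) (\<xi> q) = \<epsilon>" for q
    using metric_characteristic[OF ap \<xi>] \<eta>\<xi> by simp
  have "smooth_fun A (\<lambda>q. g q (\<xi> q) (\<xi> q))"
    using g \<xi> by (simp add: pseudo_riemannian_metric_def)
  then have "X p (\<lambda>q. \<epsilon>) = 0"
    using tangent_constant[OF vector_field_tangent[OF X]] by (simp add: g\<xi>\<xi>)
  moreover have "X p (\<lambda>q. g q (\<xi> q) (\<xi> q)) = g p (nab X \<xi> p) (\<xi> p) + g p (\<xi> p) (nab X \<xi> p)"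
    using lc X \<xi> by (simp add: levi_civita_def)
  moreover have "g p (\<xi> p) (nab X \<xi> p) = g p (nab X \<xi> p) (\<xi> p)"
    by (rule sym[OF vector_field_tangent[OF \<xi>] vector_field_tangent[OF nab]])
  ultimately have "g p (nab X \<xi> p) (\<xi> p) = 0"
    by (simp add: g\<xi>\<xi>)
  then have "f p * (\<epsilon> * \<eta> p (X p)) + w p (X p) * \<epsilon> = 0"
    using expand[OF \<xi>] by (simp add: g\<xi>\<xi> metric_characteristic[OF ap X])
  then have "\<epsilon> * (f p * \<eta> p (X p) + w p (X p)) = 0"
    by (simp add: algebra_simps)
  then have w: "w p (X p) = - f p * \<eta> p (X p)"
    using \<epsilon> by auto
  have "g p (\<xi> p) (Y p) = \<epsilon> * \<eta> p (Y p)"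
    using sym[OF vector_field_tangent[OF \<xi>] vector_field_tangent[OF Y]]
      metric_characteristic[OF ap Y] by simp
  then show ?thesis
    using expand[OF Y] w by (simp add: algebra_simps)
qed

text \<open>
  As the connection is metric and torsion-free, \<open>L\<^sub>\<xi> g\<close> is twice the symmetric part of
  \<open>g(\<nabla>\<^sub>X \<xi>, Y)\<close>, which here is symmetric already.
\<close>

lemma lie_derivative_torse_forming:
  assumes ap: "almost_paracontact_metric A \<phi> \<xi> \<eta> g \<epsilon>" and lc: "levi_civita A g nab"
    and tf: "torse_forming A nab \<xi> f w"
    and X: "vector_field A X" and Y: "vector_field A Y"
  shows "lie_derivative_metric \<xi> g X Y p = 2 * g p (nab X \<xi> p) (Y p)"
proof -
  have \<xi>: "vector_field A \<xi>" and g: "pseudo_riemannian_metric A g"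
    using ap by (auto simp: almost_paracontact_metric_def)
  have nab: "vector_field A (nab V W)" if "vector_field A V" "vector_field A W" for V W
    using lc that by (simp add: levi_civita_def affine_connection_def)
  have sym: "g p u v = g p v u" if "u \<in> tangent_space A p" "v \<in> tangent_space A p" for u v
    using g that unfolding pseudo_riemannian_metric_def by blast
  have br: "lie_bracket \<xi> V p = nab \<xi> V p - nab V \<xi> p" if "vector_field A V" for V
    using lc that \<xi> unfolding levi_civita_def by (metis minus_apply)
  have "linear_on_set (tangent_space A p) (\<lambda>v. g p v (Y p))"
    and "linear_on_set (tangent_space A p) (g p (X p))"
    using g vector_field_tangent[OF X] vector_field_tangent[OF Y]
    by (simp_all add: pseudo_riemannian_metric_def)
  then have "g p (lie_bracket \<xi> X p) (Y p) = g p (nab \<xi> X p) (Y p) - g p (nab X \<xi> p) (Y p)"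
    and "g p (X p) (lie_bracket \<xi> Y p) = g p (X p) (nab \<xi> Y p) - g p (X p) (nab Y \<xi> p)"
    using linear_on_set_diff[where L = "\<lambda>v. g p v (Y p)"] linear_on_set_diff[where L = "g p (X p)"]
    by (simp_all add: br X Y \<xi> nab vector_field_tangent)
  moreover have "\<xi> p (\<lambda>q. g q (X q) (Y q)) = g p (nab \<xi> X p) (Y p) + g p (X p) (nab \<xi> Y p)"
    using lc X Y \<xi> by (simp add: levi_civita_def)
  moreover have "g p (X p) (nab Y \<xi> p) = g p (nab Y \<xi> p) (X p)"
    by (rule sym[OF vector_field_tangent[OF X] vector_field_tangent[OF nab[OF Y \<xi>]]])
  moreover have "g p (nab Y \<xi> p) (X p) = g p (nab X \<xi> p) (Y p)"
    using torse_forming_metric[OF ap lc tf X Y] torse_forming_metric[OF ap lc tf Y X]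
      sym[OF vector_field_tangent[OF X] vector_field_tangent[OF Y]]
    by simp
  ultimately show ?thesis
    by (simp add: lie_derivative_metric_def)
qed


section \<open>Parallelism and the soliton equation\<close>

theorem theorem5p4:
  fixes A :: "('m::{t2_space, second_countable_topology}, 'e::euclidean_space) chart set"
    and \<phi> :: "'m \<Rightarrow> 'm tangent_vector \<Rightarrow> 'm tangent_vector"
    and \<xi> :: "'m vfield"
    and \<eta> w :: "'m \<Rightarrow> 'm tangent_vector \<Rightarrow> real"
    and g :: "'m \<Rightarrow> 'm tangent_vector \<Rightarrow> 'm tangent_vector \<Rightarrow> real"
    and nab :: "'m vfield \<Rightarrow> 'm vfield \<Rightarrow> 'm vfield"
    and f :: "'m \<Rightarrow> real"
    and \<epsilon> a b c \<mu> :: real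
    and \<alpha> :: "'m vfield \<Rightarrow> 'm vfield \<Rightarrow> 'm \<Rightarrow> real"
  assumes "smooth_atlas A"
    and "almost_paracontact_metric A \<phi> \<xi> \<eta> g \<epsilon>"
    and "levi_civita A g nab"
    and "einstein_like A \<phi> \<eta> g nab a b c"
    and "torse_forming A nab \<xi> f w"
    and "regular \<xi> f"
    and "\<alpha> = (\<lambda>X Y p. 1 / 2 * lie_derivative_metric \<xi> g X Y p + ricci A nab X Y p
                      + \<mu> * \<eta> p (X p) * \<eta> p (Y p))"
  shows "parallel A nab \<alpha> \<longleftrightarrow> eta_ricci_soliton A nab \<eta> g \<xi> (- (a + \<epsilon> * (c + \<mu>))) \<mu>"
proof -
  note A = assms(1) and ap = assms(2) and lc = assms(3) and tf = assms(5)
  define r where "r = a + \<epsilon> * (c + \<mu>)"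
  have \<xi>: "vector_field A \<xi>" and g: "pseudo_riemannian_metric A g" and \<phi>: "tensor11 A \<phi>"
    and \<eta>: "one_form A \<eta>" and \<epsilon>: "\<epsilon> * \<epsilon> = 1"
    and \<eta>\<xi>: "\<eta> q (\<xi> q) = 1"
    and \<eta>\<phi>: "v \<in> tangent_space A q \<Longrightarrow> \<eta> q (\<phi> q v) = 0"
    and compat: "vector_field A X \<Longrightarrow> vector_field A Y \<Longrightarrow>
      g q (\<phi> q (X q)) (\<phi> q (Y q)) = g q (X q) (Y q) - \<epsilon> * \<eta> q (X q) * \<eta> q (Y q)" for q v X Y
    using ap by (auto simp: almost_paracontact_metric_def)
  have \<phi>_field: "vector_field A (\<lambda>p. \<phi> p (X p))" if "vector_field A X" for X
    using \<phi> that by (simp add: tensor11_def)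
  have soliton: "eta_ricci_soliton A nab \<eta> g \<xi> (- (a + \<epsilon> * (c + \<mu>))) \<mu> \<longleftrightarrow>
      (\<forall>X Y p. vector_field A X \<longrightarrow> vector_field A Y \<longrightarrow> \<alpha> X Y p = r * g p (X p) (Y p))"
    unfolding eta_ricci_soliton_def assms(7) r_def[symmetric]
    by (intro iff_allI imp_cong refl) (auto simp: field_simps)
  define \<beta> where "\<beta> p u v = f p * (g p u v - \<epsilon> * \<eta> p u * \<eta> p v) + a * g p u v
      + b * g p (\<phi> p u) v + (c + \<mu>) * \<eta> p u * \<eta> p v" for p u v
  have \<alpha>_\<beta>: "\<alpha> X Y p = \<beta> p (X p) (Y p)" if "vector_field A X" "vector_field A Y" for X Y p
  proof -
    have "ricci A nab X Y p =
        a * g p (X p) (Y p) + b * g p (\<phi> p (X p)) (Y p) + c * \<eta> p (X p) * \<eta> p (Y p)"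
      using assms(4) that by (simp add: einstein_like_def)
    moreover have "1 / 2 * lie_derivative_metric \<xi> g X Y p =
        f p * (g p (X p) (Y p) - \<epsilon> * \<eta> p (X p) * \<eta> p (Y p))"
      using lie_derivative_torse_forming[OF ap lc tf that, of p]
        torse_forming_metric[OF ap lc tf that, of p] by linarith
    ultimately show ?thesis
      by (simp add: assms(7) \<beta>_def algebra_simps)
  qed
  have on_\<xi>: "\<beta> p (Y p) (\<xi> p) = r * g p (Y p) (\<xi> p)" if Y: "vector_field A Y" for Y p
  proof -
    have "g p (\<phi> p (Y p)) (\<xi> p) = 0"
      using metric_characteristic[OF ap \<phi>_field[OF Y]] \<eta>\<phi> vector_field_tangent[OF Y] by simp
    moreover have "r * (\<epsilon> * t) = a * (\<epsilon> * t) + (c + \<mu>) * t" for t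
    proof -
      have "r * (\<epsilon> * t) = a * (\<epsilon> * t) + (\<epsilon> * \<epsilon>) * ((c + \<mu>) * t)"
        by (simp add: r_def algebra_simps)
      then show ?thesis by (simp add: \<epsilon>)
    qed
    ultimately show ?thesis
      by (simp add: \<beta>_def \<eta>\<xi> metric_characteristic[OF ap Y])
  qed
  have smooth: "smooth_fun A (\<lambda>p. \<beta> p (X p) (Y p))"
    if X: "vector_field A X" and Y: "vector_field A Y" for X Y
  proof -
    have nab: "vector_field A (nab X \<xi>)"
      using lc X \<xi> by (simp add: levi_civita_def affine_connection_def)
    have smooth_g: "smooth_fun A (\<lambda>p. g p (V p) (Y p))" if "vector_field A V" for V
      using g that Y by (simp add: pseudo_riemannian_metric_def)
    have smooth_\<phi>: "smooth_fun A (\<lambda>p. g p (\<phi> p (X p)) (\<phi> p (Y p)))"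
      using g \<phi>_field[OF X] \<phi>_field[OF Y] by (simp add: pseudo_riemannian_metric_def)
    \<comment> \<open>Both products of functions in \<open>\<beta>\<close> are values of \<open>g\<close>:
      \<open>f (g(X, Y) - \<epsilon> \<eta>(X) \<eta>(Y)) = g(\<nabla>\<^sub>X \<xi>, Y)\<close> and
      \<open>\<eta>(X) \<eta>(Y) = \<epsilon> (g(X, Y) - g(\<phi> X, \<phi> Y))\<close>.\<close>
    have \<eta>\<eta>: "\<eta> p (X p) * \<eta> p (Y p) =
        \<epsilon> * (g p (X p) (Y p) - g p (\<phi> p (X p)) (\<phi> p (Y p)))" for p
      using compat[OF X Y] \<epsilon> by (simp add: mult.assoc[symmetric])
    have "\<beta> p (X p) (Y p) =
        1 * (1 * g p (nab X \<xi> p) (Y p) + r * g p (X p) (Y p))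
        + 1 * (b * g p (\<phi> p (X p)) (Y p)
          + (- \<epsilon> * (c + \<mu>)) * g p (\<phi> p (X p)) (\<phi> p (Y p)))" for p
      using torse_forming_metric[OF ap lc tf X Y, of p]
      unfolding \<beta>_def r_def mult.assoc[of _ "\<eta> p (X p)"] \<eta>\<eta> by (simp add: algebra_simps)
    then show ?thesis
      by (simp only: smooth_fun_linear_combination[OF A] smooth_g smooth_\<phi> nab X \<phi>_field)
  qed
  have lin: "linear_on_set (tangent_space A p) (\<beta> p u)" if u: "u \<in> tangent_space A p" for p u
  proof -
    have "\<phi> p u \<in> tangent_space A p"
      using \<phi> u by (auto simp: tensor11_def)
    then have "linear_on_set (tangent_space A p) (g p u)"
      "linear_on_set (tangent_space A p) (g p (\<phi> p u))"
      "linear_on_set (tangent_space A p) (\<eta> p)"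
      using g u \<eta> by (simp_all add: pseudo_riemannian_metric_def one_form_def)
    then show ?thesis
      by (simp add: linear_on_set_def \<beta>_def algebra_simps)
  qed
  show ?thesis
    unfolding soliton
  proof (intro iffI allI impI)
    fix X Y p
    assume par: "parallel A nab \<alpha>" and X: "vector_field A X" and Y: "vector_field A Y"
    have nab: "vector_field A (nab V W)" if "vector_field A V" "vector_field A W" for V W
      using lc that by (simp add: levi_civita_def affine_connection_def)
    have "\<alpha> V W = (\<lambda>q. \<beta> q (V q) (W q))" if "vector_field A V" "vector_field A W" for V W
      using \<alpha>_\<beta>[OF that] by auto
    with nab have par_\<beta>: "parallel A nab (\<lambda>X Y p. \<beta> p (X p) (Y p))"
      using par unfolding parallel_def by simp
    show "\<alpha> X Y p = r * g p (X p) (Y p)"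
      unfolding \<alpha>_\<beta>[OF X Y]
      by (rule parallel_eq_multiple_of_metric[where A = A and g = g and nab = nab and \<xi> = \<xi>
            and f = f and w = w and \<beta> = \<beta> and r = r and X = Y and Y = X and p = p])
        (fact A g lc \<xi> tf assms(6) lin smooth par_\<beta> on_\<xi> Y X)+
  qed (use parallel_multiple_of_metric[OF g lc] in blast)
qed

end
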